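(* Let $\boldsymbol{a}=(a_n)_{n\ge1}$ be the sequence of Schur parameters of a probability measure $\mu$ on $\mathbb{T}$ with infinite support and let $\boldsymbol{u}=(u_n)_{n\ge1}$ be a sequence in $\mathbb{T}$. Then $$\overline{\overline{\lim_n}}\,\Sigma_n(\boldsymbol{a};\boldsymbol{u})\setminus\mathrm{supp}\,\mu\subset\mathfrak{L}\left\{\frac{u_{n+1}}{u_n}\,\frac{1-\overline{a}_nu_n}{1-a_n\overline{u}_n}\right\}.$$
   Context: $\mathbb{T}=\{z\in\mathbb{C}:|z|=1\}$. Let $(\varphi_n)_{n\ge0}$ be the orthonormal polynomials in $L^2_\mu$, $\varphi_n(z)=\kappa_n(z^n+\cdots+a_n)$, $\kappa_n>0$; $a_n$ ($n\ge1$) are the Schur parameters of $\mu$, $|a_n|<1$. For a polynomial $p$ of degree $n$, $p^*(z):=z^n\overline p(z^{-1})$ ($\overline p$ has the conjugated coefficients). For $u\in\mathbb{T}$, $p_n^u(z):=z\varphi_{n-1}(z)+u\varphi_{n-1}^*(z)$, and $\Sigma_n(\boldsymbol{a};\boldsymbol{u}):=\{z\in\mathbb{C}:p_n^{u_n}(z)=0\}$. For a sequence $(E_n)_{n\ge1}$ of subsets of $\mathbb{C}$, $\overline{\overline{\lim}}_nE_n$ (double limit points) is the set of $\lambda\in\mathbb{C}$ such that for some infinite set $\mathcal{I}\subset\mathbb{N}$, $\lim_{n\in\mathcal{I}}d(\lambda,E_n)=\lim_{n\in\mathcal{I}}d(\lambda,E_{n+1})=0$, $d$ being the distance from a point to a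 set. $\mathfrak{L}\{c_n\}$ denotes the set of limit points (limits of subsequences) of a sequence $(c_n)$ in $\mathbb{C}$. *)

theory Defs
  imports "HOL-Probability.Probability" "HOL-Computational_Algebra.Polynomial"
begin

definition measure_supp :: "'a::topological_space measure \<Rightarrow> 'a set" where
  "measure_supp \<mu> =
     {z \<in> space \<mu>. \<forall>U. open U \<longrightarrow> z \<in> U \<longrightarrow> emeasure \<mu> (U \<inter> space \<mu>) > 0}"

text \<open>The leading coefficients are required to be positive reals, so the sequence is uniquely
  determined by the measure.\<close>

definition orthonormal_polys :: "complex measure \<Rightarrow> (nat \<Rightarrow> complex poly) \<Rightarrow> bool" where
  "orthonormal_polys \<mu> \<phi> \<longleftrightarrow>
     (\<forall>n. degree (\<phi> n) = n \<and> (\<exists>\<kappa>::real. \<kappa> > 0 \<and> lead_coeff (\<phi> n) = of_real \<kappa>)) \<and>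
     (\<forall>m n. (\<integral>z. poly (\<phi> m) z * cnj (poly (\<phi> n) z) \<partial>\<mu>) = (if m = n then 1 else 0))"

text \<open>If \<open>\<phi>\<^sub>n(z) = \<kappa>\<^sub>n (z\<^sup>n + \<dots> + a\<^sub>n)\<close>, the Schur parameter is \<open>a\<^sub>n\<close>.\<close>

definition schur_param :: "(nat \<Rightarrow> complex poly) \<Rightarrow> nat \<Rightarrow> complex" where
  "schur_param \<phi> n = coeff (\<phi> n) 0 / lead_coeff (\<phi> n)"

text \<open>\<open>p\<^sup>*(z) = z\<^sup>n cnj(p)(1/z)\<close>, where \<open>n\<close> is the degree of \<open>p\<close> and \<open>cnj(p)\<close> has the
  conjugated coefficients.\<close>

definition star_poly :: "complex poly \<Rightarrow> complex poly" where
  "star_poly p = reflect_poly (map_poly cnj p)"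

definition para_orthogonal :: "(nat \<Rightarrow> complex poly) \<Rightarrow> complex \<Rightarrow> nat \<Rightarrow> complex poly" where
  "para_orthogonal \<phi> v n = [:0, 1:] * \<phi> (n - 1) + smult v (star_poly (\<phi> (n - 1)))"

text \<open>Only indices \<open>n \<ge> 1\<close> are meaningful.\<close>

definition para_zeros :: "(nat \<Rightarrow> complex poly) \<Rightarrow> (nat \<Rightarrow> complex) \<Rightarrow> nat \<Rightarrow> complex set" where
  "para_zeros \<phi> u n = {z. poly (para_orthogonal \<phi> (u n) n) z = 0}"

text \<open>Sequences are indexed by \<open>n \<ge> 1\<close>. The distance from a point to the empty set is understood
  to be infinite, whereas \<^term>\<open>infdist x {}\<close> is \<open>0\<close>; hence empty sets are excluded explicitly.\<close>

definition double_limit_points :: "(nat \<Rightarrow> complex set) \<Rightarrow> complex set" where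
  "double_limit_points E =
     {x. \<exists>I. infinite I \<and> I \<subseteq> {n. n \<ge> 1 \<and> E n \<noteq> {} \<and> E (n + 1) \<noteq> {}} \<and>
            ((\<lambda>n. infdist x (E n)) \<longlongrightarrow> 0) (inf sequentially (principal I)) \<and>
            ((\<lambda>n. infdist x (E (n + 1))) \<longlongrightarrow> 0) (inf sequentially (principal I))}"

definition subseq_limits :: "(nat \<Rightarrow> complex) \<Rightarrow> complex set" where
  "subseq_limits c = {l. \<exists>r. strict_mono r \<and> (c \<circ> r) \<longlonglongrightarrow> l}"

end

theory Submission
  imports Defs
begin

text \<open>
  Write \<open>b\<^sub>n(z) = z \<phi>\<^sub>n(z) / \<phi>\<^sub>n\<^sup>*(z)\<close>, a function of modulus one on the circle. The zeros of the
  para-orthogonal polynomial of degree \<open>n + 1\<close> with parameter \<open>v\<close> are the points of the circle where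
  \<open>b\<^sub>n = -v\<close>. The Szego recurrence expresses \<open>b\<^sub>n\<close> through \<open>b\<^bsub>n-1\<^esub>\<close>, so at a zero \<open>z\<close> of the
  polynomial of degree \<open>n\<close> with parameter \<open>u\<^sub>n\<close> the value of \<open>b\<^sub>n\<close> is known as well:
  \<open>b\<^sub>n(z) = - z u\<^sub>n (1 - a\<^sub>n cnj u\<^sub>n) / (1 - cnj a\<^sub>n u\<^sub>n)\<close>. At a zero \<open>w\<close> of the next polynomial
  \<open>b\<^sub>n(w) = - u\<^bsub>n+1\<^esub>\<close>. Hence, if \<open>c\<^sub>n\<close> denotes the \<open>n\<close>-th term of the sequence of the theorem,
  \<open>|c\<^sub>n - z| = |b\<^sub>n(z) - b\<^sub>n(w)|\<close>. If \<open>z\<close> and \<open>w\<close> both tend to \<open>\<lambda>\<close>, then \<open>c\<^sub>n\<close> tends to \<open>\<lambda>\<close>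
  as soon as the functions \<open>b\<^sub>n\<close> are equicontinuous near \<open>\<lambda>\<close>.

  Off the support they are even uniformly Lipschitz. By the Christoffel-Darboux formula the difference
  quotient of \<open>b\<^sub>n\<close> has modulus \<open>|K\<^sub>n(z,w)| / (|\<phi>\<^sub>n(z)| |\<phi>\<^sub>n(w)|)\<close>, where \<open>K\<^sub>n\<close> is the reproducing
  kernel of the polynomials of degree at most \<open>n\<close>; by Cauchy-Schwarz it suffices to bound
  \<open>K\<^sub>n(z,z) / |\<phi>\<^sub>n(z)|\<^sup>2\<close>. If the distance from \<open>z\<close> to the support is at least \<open>d\<close>, then
  \<open>d\<^sup>2 K\<^sub>n(z,z) = d\<^sup>2 \<integral>|K\<^sub>n(x,z)|\<^sup>2 d\<mu> \<le> \<integral>|(1 - x cnj z) K\<^sub>n(x,z)|\<^sup>2 d\<mu>\<close>, and by the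
  Christoffel-Darboux formula again the integrand on the right is at most
  \<open>4 |\<phi>\<^sub>n(z)|\<^sup>2 |\<phi>\<^sub>n(x)|\<^sup>2\<close>, whose integral is \<open>4 |\<phi>\<^sub>n(z)|\<^sup>2\<close>. This is
  \<open>kernel_diag_gap_bound\<close>; it also shows that \<open>\<phi>\<^sub>n\<close> does not vanish at such \<open>z\<close>, so that no
  denominator above is zero. The resulting estimate for \<open>|c\<^sub>n - z|\<close> is \<open>para_zero_dist\<close>.
\<close>

section \<open>Reversed polynomials on the unit circle\<close>

lemma degree_star_poly_le: "degree (star_poly p) \<le> degree p"
  unfolding star_poly_def using degree_reflect_poly_le[of "map_poly cnj p"]
  by (simp add: degree_map_poly)

lemma unit_mult_cnj: "norm z = 1 \<Longrightarrow> z * cnj z = 1"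
  by (metis complex_norm_square of_real_1 one_power2)

lemma coeff_star_poly:
  "coeff (star_poly p) k = (if k \<le> degree p then cnj (coeff p (degree p - k)) else 0)"
  by (simp add: star_poly_def coeff_reflect_poly coeff_map_poly degree_map_poly)

lemma poly_star_poly_unit:
  assumes "norm z = 1"
  shows "poly (star_poly p) z = z ^ degree p * cnj (poly p z)"
proof -
  have "z \<noteq> 0" using assms by auto
  moreover have "inverse z = cnj z" using unit_mult_cnj[OF assms] by (rule inverse_unique)
  ultimately have "poly (star_poly p) z = z ^ degree p * poly (map_poly cnj p) (cnj z)"
    by (simp only: star_poly_def poly_reflect_poly_nz degree_map_poly complex_cnj_zero_iff not_False_eq_True)
  then show ?thesis by (simp only: poly_cnj complex_cnj_cnj)
qed

section \<open>The inner product and the orthonormal basis\<close>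

locale circle_OP = prob_space \<mu> for \<mu> :: "complex measure" +
  fixes \<phi> :: "nat \<Rightarrow> complex poly"
  assumes sets_mu: "sets \<mu> = sets (restrict_space borel (sphere 0 1))"
    and ortho: "orthonormal_polys \<mu> \<phi>"
begin

definition \<kappa> :: "nat \<Rightarrow> real" where "\<kappa> n = Re (lead_coeff (\<phi> n))"

definition ip :: "complex poly \<Rightarrow> complex poly \<Rightarrow> complex" where
  "ip p q = (\<integral>z. poly p z * cnj (poly q z) \<partial>\<mu>)"

lemma degree_phi [simp]: "degree (\<phi> n) = n"
  and kappa_pos: "\<kappa> n > 0"
  and coeff_phi: "coeff (\<phi> n) n = of_real (\<kappa> n)"
  and ip_phi: "ip (\<phi> m) (\<phi> n) = (if m = n then 1 else 0)"
proof -
  from ortho show d: "degree (\<phi> n) = n" and "ip (\<phi> m) (\<phi> n) = (if m = n then 1 else 0)"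
    unfolding orthonormal_polys_def ip_def by blast+
  from ortho obtain k where "k > 0" "lead_coeff (\<phi> n) = of_real k"
    unfolding orthonormal_polys_def by blast
  with d show "\<kappa> n > 0" "coeff (\<phi> n) n = of_real (\<kappa> n)"
    by (simp_all add: \<kappa>_def)
qed

lemma phi_0: "\<phi> 0 = [:of_real (\<kappa> 0):]"
  using degree_phi[of 0] coeff_phi[of 0] by (metis coeff_pCons_0 degree_eq_zeroE)

lemma space_mu: "space \<mu> = sphere 0 1"
  using sets_eq_imp_space_eq[OF sets_mu] by (simp add: space_restrict_space)

lemma continuous_integrable:
  fixes f :: "complex \<Rightarrow> 'b :: {banach, second_countable_topology}"
  assumes "continuous_on UNIV f"
  shows "integrable \<mu> f"
proof -
  have c: "continuous_on (sphere 0 1) f"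
    using assms continuous_on_subset by blast
  then have "f \<in> borel_measurable (restrict_space borel (sphere 0 1))"
    by (rule borel_measurable_continuous_on_restrict)
  then have m: "f \<in> borel_measurable \<mu>"
    using measurable_cong_sets[OF sets_mu refl] by blast
  have "compact (f ` sphere 0 1)" using c by (intro compact_continuous_image) auto
  then obtain B where "\<And>z. z \<in> sphere 0 1 \<Longrightarrow> norm (f z) \<le> B"
    using compact_imp_bounded bounded_iff by (metis imageI)
  then show ?thesis
    by (intro integrable_const_bound[OF _ m, of B] AE_I2) (simp add: space_mu)
qed

lemma ip_integrable: "integrable \<mu> (\<lambda>z. poly p z * cnj (poly q z))"
  by (intro continuous_integrable continuous_intros)

lemma ip_cong:
  assumes "\<And>z. norm z = 1 \<Longrightarrow> poly p z * cnj (poly q z) = poly p' z * cnj (poly q' z)"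
  shows "ip p q = ip p' q'"
  unfolding ip_def by (rule Bochner_Integration.integral_cong) (use assms space_mu in auto)

lemma ip_add_left: "ip (p + q) r = ip p r + ip q r"
  unfolding ip_def by (simp add: ring_distribs ip_integrable)

lemma ip_smult_left: "ip (smult c p) r = c * ip p r"
  unfolding ip_def by (simp add: mult.assoc)

lemma ip_cnj: "cnj (ip p q) = ip q p"
  unfolding ip_def Bochner_Integration.integral_cnj[symmetric] by (simp add: mult.commute)

lemma ip_0_left [simp]: "ip 0 p = 0"
  by (simp add: ip_def)

lemma ip_sum_left: "finite A \<Longrightarrow> ip (sum f A) r = (\<Sum>k\<in>A. ip (f k) r)"
  by (induction A rule: finite_induct) (simp_all add: ip_add_left)

lemma ip_add_right: "ip r (p + q) = ip r p + ip r q"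
  by (metis ip_add_left ip_cnj complex_cnj_add)

lemma ip_smult_right: "ip r (smult c p) = cnj c * ip r p"
  by (metis ip_smult_left ip_cnj complex_cnj_mult)

lemma ip_sum_right: "finite A \<Longrightarrow> ip r (sum f A) = (\<Sum>k\<in>A. ip r (f k))"
  using ip_sum_left[of A f r] ip_cnj by (metis (mono_tags, lifting) cnj_sum sum.cong)

text \<open>Since \<open>\<phi>\<^sub>k\<close> has degree exactly \<open>k\<close>, subtracting the right multiple of \<open>\<phi>\<^bsub>m\<^esub>\<close> lowers the
  degree.\<close>
lemma phi_span:
  assumes "degree p \<le> m"
  shows "\<exists>c. p = (\<Sum>k\<le>m. smult (c k) (\<phi> k))"
  using assms
proof (induction m arbitrary: p)
  case 0
  then have "p = smult (coeff p 0 / of_real (\<kappa> 0)) (\<phi> 0)"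
    using kappa_pos[of 0] coeff_phi[of 0]
    by (intro poly_eqI) (metis (no_types, lifting) coeff_eq_0 coeff_smult degree_phi
        gr0I le_0_eq mult_zero_right nonzero_eq_divide_eq of_real_eq_0_iff less_irrefl)
  then show ?case by (intro exI[of _ "\<lambda>_. coeff p 0 / of_real (\<kappa> 0)"]) simp
next
  case (Suc m)
  define b where "b = coeff p (Suc m) / of_real (\<kappa> (Suc m))"
  define q where "q = p - smult b (\<phi> (Suc m))"
  have "degree q \<le> m"
  proof (rule degree_le, intro allI impI)
    fix i assume "m < i"
    show "coeff q i = 0"
    proof (cases "i = Suc m")
      case True
      then show ?thesis using kappa_pos[of "Suc m"] by (simp add: q_def b_def coeff_phi)
    next
      case False
      with \<open>m < i\<close> Suc.prems show ?thesis by (simp add: q_def coeff_eq_0)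
    qed
  qed
  from Suc.IH[OF this] obtain c where c: "q = (\<Sum>k\<le>m. smult (c k) (\<phi> k))" by blast
  have "p = (\<Sum>k\<le>Suc m. smult ((c(Suc m := b)) k) (\<phi> k))"
    using c by (simp add: q_def algebra_simps)
  then show ?case by blast
qed

lemma phi_orthogonal_lower:
  assumes "degree p < m"
  shows "ip (\<phi> m) p = 0"
proof -
  obtain c where "p = (\<Sum>k\<le>degree p. smult (c k) (\<phi> k))" using phi_span[of p] by blast
  then have "ip (\<phi> m) p = (\<Sum>k\<le>degree p. cnj (c k) * ip (\<phi> m) (\<phi> k))"
    by (metis (no_types, lifting) finite_atMost ip_smult_right ip_sum_right sum.cong)
  also have "\<dots> = 0" using assms by (intro sum.neutral) (auto simp: ip_phi)
  finally show ?thesis .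
qed

lemma parseval:
  "ip (\<Sum>k\<le>m. smult (c k) (\<phi> k)) (\<Sum>k\<le>m. smult (c k) (\<phi> k)) = of_real (\<Sum>k\<le>m. (norm (c k))\<^sup>2)"
proof -
  have "ip (\<phi> j) (\<Sum>k\<le>m. smult (c k) (\<phi> k)) = cnj (c j)" if "j \<le> m" for j
    using that by (simp add: ip_sum_right ip_smult_right ip_phi mult_delta_right)
  then have "ip (\<Sum>k\<le>m. smult (c k) (\<phi> k)) (\<Sum>k\<le>m. smult (c k) (\<phi> k))
      = (\<Sum>j\<le>m. c j * cnj (c j))"
    by (simp only: ip_sum_left[OF finite_atMost] ip_smult_left) simp
  also have "\<dots> = of_real (\<Sum>k\<le>m. (norm (c k))\<^sup>2)"
    by (simp only: of_real_sum complex_norm_square)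
  finally show ?thesis .
qed

text \<open>The polynomials \<open>\<phi>\<^sub>0, \<dots>, \<phi>\<^bsub>m\<^esub>\<close> span those of degree at most \<open>m\<close>, so Parseval's identity
  forces all coefficients to vanish.\<close>
lemma ip_definite:
  assumes "ip p p = 0"
  shows "p = 0"
proof -
  obtain c where c: "p = (\<Sum>k\<le>degree p. smult (c k) (\<phi> k))" using phi_span[of p] by blast
  then have "ip p p = of_real (\<Sum>k\<le>degree p. (norm (c k))\<^sup>2)" using parseval by metis
  with assms have "(\<Sum>k\<le>degree p. (norm (c k))\<^sup>2) = 0" by (metis of_real_eq_0_iff)
  then have "\<forall>k\<in>{..degree p}. c k = 0" by (simp add: sum_nonneg_eq_0_iff)
  with c show ?thesis by (metis (no_types, lifting) smult_0_left sum.neutral)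
qed

text \<open>Multiplication by \<open>z\<close> is an isometry because \<open>|z| = 1\<close> on the circle; together with the
  next lemma this is the special feature of measures on the circle behind the Szego recurrence.\<close>
lemma ip_shift: "ip (pCons 0 p) (pCons 0 q) = ip p q"
proof (rule ip_cong)
  fix z :: complex assume "norm z = 1"
  then have "z * cnj z = 1" by (rule unit_mult_cnj)
  then show "poly (pCons 0 p) z * cnj (poly (pCons 0 q) z) = poly p z * cnj (poly q z)"
    by (simp add: algebra_simps)
qed

lemma ip_star: "degree p = degree q \<Longrightarrow> ip (star_poly p) (star_poly q) = ip q p"
proof (rule ip_cong)
  fix z :: complex assume "norm z = 1" and d: "degree p = degree q"
  then have *: "z * cnj z = 1" by (intro unit_mult_cnj)
  have "z ^ degree q * cnj (z ^ degree q) = 1"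
    using * by (simp flip: power_mult_distrib)
  then show "poly (star_poly p) z * cnj (poly (star_poly q) z) = poly q z * cnj (poly p z)"
    using \<open>norm z = 1\<close> d by (simp add: poly_star_poly_unit algebra_simps)
qed

text \<open>On the circle, \<open>\<phi>\<^sub>n\<^sup>*(z) cnj (z q(z))\<close> equals \<open>r(z) cnj (\<phi>\<^sub>n(z))\<close> for the reversal
  \<open>r(z) = z\<^bsup>n-1\<^esup> cnj (q(z))\<close> of \<open>q\<close> in degree \<open>n - 1\<close>, and \<open>\<phi>\<^sub>n\<close> is orthogonal to \<open>r\<close>.\<close>
lemma star_phi_orthogonal:
  assumes "degree q < n"
  shows "ip (star_poly (\<phi> n)) (pCons 0 q) = 0"
proof -
  define r where "r = monom 1 (n - 1 - degree q) * star_poly q"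
  have "degree r \<le> (n - 1 - degree q) + degree q"
    unfolding r_def
    by (rule order.trans[OF degree_mult_le]) (intro add_mono degree_monom_le degree_star_poly_le)
  with assms have "degree r < n" by linarith
  have "ip (star_poly (\<phi> n)) (pCons 0 q) = ip r (\<phi> n)"
  proof (rule ip_cong)
    fix z :: complex assume z: "norm z = 1"
    then have *: "z * cnj z = 1" by (rule unit_mult_cnj)
    obtain m where m: "n = Suc m" using assms by (cases n) auto
    with assms have "z ^ (n - 1 - degree q) * z ^ degree q = z ^ m"
      by (simp flip: power_add)
    then have "poly r z = z ^ m * cnj (poly q z)"
      using z by (simp add: r_def poly_monom poly_star_poly_unit flip: mult.assoc)
    moreover have "poly (star_poly (\<phi> n)) z * cnj (poly (pCons 0 q) z)
       = (z * cnj z) * (z ^ m * cnj (poly q z) * cnj (poly (\<phi> n) z))"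
      using z by (simp add: poly_star_poly_unit m)
    ultimately show "poly (star_poly (\<phi> n)) z * cnj (poly (pCons 0 q) z)
        = poly r z * cnj (poly (\<phi> n) z)"
      using * by simp
  qed
  also have "\<dots> = 0" using phi_orthogonal_lower[OF \<open>degree r < n\<close>] ip_cnj by (metis complex_cnj_zero)
  finally show ?thesis .
qed

section \<open>Szego recurrence and Christoffel-Darboux formula\<close>

text \<open>The difference \<open>D\<close> of the two sides has degree at most \<open>n\<close> and no constant term: the leading
  coefficients cancel by the choice of the factor, the constant ones by the definition of the Schur
  parameter. Each of \<open>\<phi>\<^bsub>n+1\<^esub>\<close>, \<open>z \<phi>\<^sub>n\<close> and \<open>\<phi>\<^sub>n\<^sup>*\<close> is orthogonal to all such polynomials, so
  \<open>D\<close> is orthogonal to itself.\<close>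
lemma szego_recurrence:
  "\<phi> (Suc n) = smult (of_real (\<kappa> (Suc n) / \<kappa> n))
     (pCons 0 (\<phi> n) + smult (schur_param \<phi> (Suc n)) (star_poly (\<phi> n)))"
proof -
  define c where "c = complex_of_real (\<kappa> (Suc n) / \<kappa> n)"
  define b where "b = schur_param \<phi> (Suc n)"
  define D where "D = \<phi> (Suc n) - smult c (pCons 0 (\<phi> n) + smult b (star_poly (\<phi> n)))"
  have kn: "\<kappa> n \<noteq> 0" "\<kappa> (Suc n) \<noteq> 0" using kappa_pos by (metis less_irrefl)+
  have "degree D \<le> n"
  proof (rule degree_le, intro allI impI)
    fix i assume "n < i"
    show "coeff D i = 0"
    proof (cases "i = Suc n")
      case True
      then show ?thesis using kn by (simp add: D_def c_def coeff_star_poly coeff_phi)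
    next
      case False
      with \<open>n < i\<close> obtain j where "i = Suc j" "n < j" by (cases i) auto
      then show ?thesis by (simp add: D_def coeff_star_poly coeff_eq_0)
    qed
  qed
  have "coeff D 0 = 0"
    using kn by (simp add: D_def c_def b_def coeff_star_poly coeff_phi schur_param_def)
  then obtain E where E: "D = pCons 0 E" by (metis coeff_pCons_0 pCons_cases)
  \<comment> \<open>If \<open>E\<close> is nonzero, its degree is less than \<open>n\<close>; in particular \<open>n > 0\<close>.\<close>
  have "E = 0"
  proof (rule ccontr)
    assume "E \<noteq> 0"
    with E \<open>degree D \<le> n\<close> have dE: "degree E < n" by simp
    have "\<phi> (Suc n) = D + smult c (pCons 0 (\<phi> n) + smult b (star_poly (\<phi> n)))"
      by (simp add: D_def)
    then have "ip (\<phi> (Suc n)) D = ip D D + c * (ip (pCons 0 (\<phi> n)) D + b * ip (star_poly (\<phi> n)) D)"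
      by (metis ip_add_left ip_smult_left)
    moreover have "ip (\<phi> (Suc n)) D = 0"
      using \<open>degree D \<le> n\<close> by (intro phi_orthogonal_lower) simp
    moreover have "ip (pCons 0 (\<phi> n)) D = 0" "ip (star_poly (\<phi> n)) D = 0"
      using dE by (simp_all add: E ip_shift phi_orthogonal_lower star_phi_orthogonal)
    ultimately have "ip D D = 0" by simp
    then have "D = 0" by (rule ip_definite)
    with E \<open>E \<noteq> 0\<close> show False by simp
  qed
  with E have "D = 0" by simp
  then show ?thesis by (simp add: D_def c_def b_def)
qed

lemma szego_recurrence_star:
  "star_poly (\<phi> (Suc n)) = smult (of_real (\<kappa> (Suc n) / \<kappa> n))
     (star_poly (\<phi> n) + smult (cnj (schur_param \<phi> (Suc n))) (pCons 0 (\<phi> n)))"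
proof (rule poly_eqI)
  fix k
  define c where "c = \<kappa> (Suc n) / \<kappa> n"
  define b where "b = schur_param \<phi> (Suc n)"
  have rec: "coeff (\<phi> (Suc n)) i = of_real c * (coeff (pCons 0 (\<phi> n)) i + b * coeff (star_poly (\<phi> n)) i)" for i
    using arg_cong[OF szego_recurrence[of n], of "\<lambda>p. coeff p i"]
    unfolding c_def b_def by simp
  have "coeff (star_poly (\<phi> (Suc n))) k
      = of_real c * (coeff (star_poly (\<phi> n)) k + cnj b * coeff (pCons 0 (\<phi> n)) k)"
  proof (cases k)
    case 0
    then show ?thesis by (simp add: coeff_star_poly[of "\<phi> (Suc n)"] rec) (simp add: coeff_star_poly)
  next
    case (Suc j)
    consider "j < n" | "j = n" | "j > n" by linarith
    then show ?thesis
    proof cases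
      case 1
      then have "n - j = Suc (n - Suc j)" by simp
      with 1 Suc show ?thesis
        by (simp add: coeff_star_poly[of "\<phi> (Suc n)"] rec) (simp add: coeff_star_poly)
    next
      case 2
      with Suc show ?thesis
        by (simp add: coeff_star_poly[of "\<phi> (Suc n)"] rec) (simp add: coeff_star_poly)
    next
      case 3
      with Suc show ?thesis by (simp add: coeff_star_poly coeff_eq_0)
    qed
  qed
  then show "coeff (star_poly (\<phi> (Suc n))) k = coeff (smult (of_real (\<kappa> (Suc n) / \<kappa> n))
     (star_poly (\<phi> n) + smult (cnj (schur_param \<phi> (Suc n))) (pCons 0 (\<phi> n)))) k"
    by (simp only: coeff_smult coeff_add c_def b_def)
qed

text \<open>Pythagoras in the Szego recurrence: \<open>\<phi>\<^bsub>n+1\<^esub>\<close> is orthogonal to \<open>\<phi>\<^sub>n\<^sup>*\<close>, while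
  \<open>\<phi>\<^bsub>n+1\<^esub>\<close>, \<open>z \<phi>\<^sub>n\<close> and \<open>\<phi>\<^sub>n\<^sup>*\<close> all have norm one.\<close>
lemma kappa_ratio:
  "(\<kappa> (Suc n) / \<kappa> n)\<^sup>2 * (1 - (norm (schur_param \<phi> (Suc n)))\<^sup>2) = 1"
proof -
  define c where "c = complex_of_real (\<kappa> (Suc n) / \<kappa> n)"
  define b where "b = schur_param \<phi> (Suc n)"
  define S where "S = star_poly (\<phi> n)"
  have rec: "smult c (pCons 0 (\<phi> n)) = \<phi> (Suc n) + smult (- c * b) S"
    using szego_recurrence[of n] by (simp add: c_def b_def S_def smult_add_right)
  have "degree S < Suc n"
    using degree_star_poly_le[of "\<phi> n"] by (simp add: S_def)
  then have orth: "ip (\<phi> (Suc n)) S = 0" "ip S (\<phi> (Suc n)) = 0"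
    using phi_orthogonal_lower ip_cnj by (metis complex_cnj_zero)+
  have SS: "ip S S = 1" by (simp add: S_def ip_star ip_phi)
  have "c * cnj c = ip (smult c (pCons 0 (\<phi> n))) (smult c (pCons 0 (\<phi> n)))"
    unfolding ip_smult_left ip_smult_right ip_shift by (simp add: ip_phi)
  also have "\<dots> = 1 + c * b * cnj (c * b)"
    unfolding rec ip_add_left ip_add_right ip_smult_left ip_smult_right
    using orth SS by (simp add: ip_phi)
  also have "1 + c * b * cnj (c * b) = 1 + (c * cnj c) * (b * cnj b)" by simp
  finally have "c * cnj c = 1 + (c * cnj c) * (b * cnj b)" .
  then have "complex_of_real ((\<kappa> (Suc n) / \<kappa> n)\<^sup>2) = of_real (1 + (\<kappa> (Suc n) / \<kappa> n)\<^sup>2 * (norm b)\<^sup>2)"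
    by (simp only: of_real_add of_real_mult complex_norm_square power2_eq_square[of "_ / _"]
        c_def complex_cnj_complex_of_real of_real_1)
  then show ?thesis unfolding of_real_eq_iff by (simp add: b_def algebra_simps)
qed

definition kernel :: "nat \<Rightarrow> complex \<Rightarrow> complex \<Rightarrow> complex" where
  "kernel n z w = (\<Sum>k\<le>n. poly (\<phi> k) z * cnj (poly (\<phi> k) w))"

text \<open>In the induction step the recurrence acts on the pair \<open>(\<phi>\<^sub>n\<^sup>*, z \<phi>\<^sub>n)\<close> by a matrix that
  preserves the indefinite form \<open>s(z) cnj (s(w)) - p(z) cnj (p(w))\<close>: its factor
  \<open>(\<kappa>\<^bsub>n+1\<^esub> / \<kappa>\<^sub>n)\<^sup>2 (1 - |a\<^bsub>n+1\<^esub>|\<^sup>2)\<close> is one by \<open>kappa_ratio\<close>.\<close>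
lemma christoffel_darboux:
  "(1 - z * cnj w) * kernel n z w = poly (star_poly (\<phi> n)) z * cnj (poly (star_poly (\<phi> n)) w)
     - z * cnj w * poly (\<phi> n) z * cnj (poly (\<phi> n) w)"
proof (induction n)
  case 0
  show ?case by (simp add: phi_0 kernel_def star_poly_def map_poly_pCons algebra_simps)
next
  case (Suc n)
  define c where "c = \<kappa> (Suc n) / \<kappa> n"
  define b where "b = schur_param \<phi> (Suc n)"
  define P where "P = (\<lambda>x. x * poly (\<phi> n) x)"
  define S where "S = poly (star_poly (\<phi> n))"
  have p: "poly (\<phi> (Suc n)) x = of_real c * (P x + b * S x)" for x
    by (subst szego_recurrence) (simp add: c_def b_def P_def S_def)
  have s: "poly (star_poly (\<phi> (Suc n))) x = of_real c * (S x + cnj b * P x)" for x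
    by (subst szego_recurrence_star) (simp add: c_def b_def P_def S_def)
  have cb: "complex_of_real c * of_real c * (1 - b * cnj b) = 1"
    using arg_cong[OF kappa_ratio[of n], of complex_of_real]
    unfolding c_def[symmetric] b_def[symmetric] of_real_mult of_real_diff complex_norm_square
      power2_eq_square[of c] of_real_1 .
  have "poly (star_poly (\<phi> (Suc n))) z * cnj (poly (star_poly (\<phi> (Suc n))) w)
      - poly (\<phi> (Suc n)) z * cnj (poly (\<phi> (Suc n)) w)
      = (of_real c * of_real c * (1 - b * cnj b)) * (S z * cnj (S w) - P z * cnj (P w))"
    unfolding p s by (simp add: algebra_simps)
  also have "\<dots> = (1 - z * cnj w) * kernel n z w"
    unfolding cb Suc.IH by (simp add: S_def P_def algebra_simps)
  finally show ?case
    by (simp add: kernel_def algebra_simps)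
qed

lemma kernel_diag: "kernel n z z = of_real (\<Sum>k\<le>n. (norm (poly (\<phi> k) z))\<^sup>2)"
  unfolding kernel_def of_real_sum complex_norm_square ..

lemma kernel_diag_pos: "(\<Sum>k\<le>n. (norm (poly (\<phi> k) z))\<^sup>2) > 0"
proof -
  have "(norm (poly (\<phi> 0) z))\<^sup>2 > 0" using kappa_pos[of 0] by (simp add: phi_0)
  then show ?thesis by (intro sum_pos2[of _ 0]) auto
qed

text \<open>A zero satisfies \<open>|z \<phi>\<^sub>n(z)| = |\<phi>\<^sub>n\<^sup>*(z)|\<close>, whereas the difference of the squares is
  \<open>(1 - |z|\<^sup>2) K\<^sub>n(z,z)\<close> by the Christoffel-Darboux formula, with \<open>K\<^sub>n(z,z) > 0\<close>.\<close>
lemma para_zero_unit: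
  assumes "poly (para_orthogonal \<phi> v (Suc n)) z = 0" "norm v = 1"
  shows "norm z = 1"
proof -
  have "z * poly (\<phi> n) z = - (v * poly (star_poly (\<phi> n)) z)"
    using assms(1) by (simp add: para_orthogonal_def eq_neg_iff_add_eq_0)
  then have e: "norm (z * poly (\<phi> n) z) = norm (poly (star_poly (\<phi> n)) z)"
    using assms(2) by (metis norm_minus_cancel norm_mult mult_1)
  have "(1 - z * cnj z) * kernel n z z = of_real ((norm (poly (star_poly (\<phi> n)) z))\<^sup>2 - (norm (z * poly (\<phi> n) z))\<^sup>2)"
    unfolding christoffel_darboux of_real_diff complex_norm_square by (simp add: algebra_simps)
  then have "(1 - z * cnj z) * kernel n z z = 0" by (simp only: e) simp
  moreover have "kernel n z z \<noteq> 0" using kernel_diag_pos[of z n] unfolding kernel_diag of_real_eq_0_iff by linarith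
  ultimately have "z * cnj z = 1" by simp
  then show ?thesis
    by (metis complex_mod_cnj complex_norm_square norm_ge_zero norm_mult norm_one one_power2 power2_eq_imp_eq power2_eq_square zero_le_one)
qed

section \<open>Estimates in a gap of the measure\<close>

text \<open>The integral of \<open>|K\<^sub>n(x,z)|\<^sup>2\<close> over \<open>x\<close> is \<open>K\<^sub>n(z,z)\<close>, and multiplying \<open>K\<^sub>n(x,z)\<close> by
  \<open>1 - x cnj z\<close>, of modulus at least \<open>d\<close> almost everywhere, leaves only the two terms of the
  Christoffel-Darboux formula, each of modulus \<open>|\<phi>\<^sub>n(x)| |\<phi>\<^sub>n(z)|\<close> on the circle.\<close>
lemma kernel_diag_gap_bound:
  assumes z: "norm z = 1" and "d > 0"
    and AE: "AE x in \<mu>. d \<le> dist x z"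
  shows "d\<^sup>2 * (\<Sum>k\<le>n. (norm (poly (\<phi> k) z))\<^sup>2) \<le> 4 * (norm (poly (\<phi> n) z))\<^sup>2"
proof -
  define q where "q = (\<Sum>k\<le>n. smult (cnj (poly (\<phi> k) z)) (\<phi> k))"
  have q: "poly q x = kernel n x z" for x
    by (simp add: q_def kernel_def poly_sum mult.commute)
  have ipn: "ip p p = of_real (\<integral>x. (norm (poly p x))\<^sup>2 \<partial>\<mu>)" for p
    unfolding ip_def by (simp flip: integral_complex_of_real complex_norm_square)
  have "of_real (\<integral>x. (norm (poly q x))\<^sup>2 \<partial>\<mu>) = ip q q"
    by (rule ipn[symmetric])
  also have "\<dots> = of_real (\<Sum>k\<le>n. (norm (poly (\<phi> k) z))\<^sup>2)"
    unfolding q_def by (simp only: parseval complex_mod_cnj)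
  finally have 1: "(\<integral>x. (norm (poly q x))\<^sup>2 \<partial>\<mu>) = (\<Sum>k\<le>n. (norm (poly (\<phi> k) z))\<^sup>2)"
    by (simp only: of_real_eq_iff)
  have 2: "(\<integral>x. (norm (poly (\<phi> n) x))\<^sup>2 \<partial>\<mu>) = 1"
    using ipn[of "\<phi> n"] ip_phi[of n n] by (metis of_real_eq_1_iff)
  have pw: "(norm (1 - x * cnj z) * norm (poly q x))\<^sup>2 \<le> (2 * norm (poly (\<phi> n) z) * norm (poly (\<phi> n) x))\<^sup>2"
    if x: "norm x = 1" for x
  proof (rule power_mono)
    have "norm (1 - x * cnj z) * norm (poly q x) = norm ((1 - x * cnj z) * kernel n x z)"
      by (simp add: q norm_mult)
    also have "\<dots> \<le> norm (poly (star_poly (\<phi> n)) x * cnj (poly (star_poly (\<phi> n)) z))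
         + norm (x * cnj z * poly (\<phi> n) x * cnj (poly (\<phi> n) z))"
      unfolding christoffel_darboux by (rule norm_triangle_ineq4)
    also have "\<dots> = 2 * norm (poly (\<phi> n) z) * norm (poly (\<phi> n) x)"
      using x z by (simp add: norm_mult poly_star_poly_unit norm_power)
    finally show "norm (1 - x * cnj z) * norm (poly q x) \<le> \<dots>" .
  qed simp
  have dz: "norm (1 - x * cnj z) = dist x z" for x
  proof -
    have "z * cnj z = 1" using z by (rule unit_mult_cnj)
    then have "1 - x * cnj z = (z - x) * cnj z" by (simp add: algebra_simps)
    then show ?thesis using z by (simp add: norm_mult dist_norm norm_minus_commute)
  qed
  have "(\<integral>x. d\<^sup>2 * (norm (poly q x))\<^sup>2 \<partial>\<mu>) \<le> (\<integral>x. 4 * (norm (poly (\<phi> n) z))\<^sup>2 * (norm (poly (\<phi> n) x))\<^sup>2 \<partial>\<mu>)"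
  proof (rule integral_mono_AE)
    show "AE x in \<mu>. d\<^sup>2 * (norm (poly q x))\<^sup>2 \<le> 4 * (norm (poly (\<phi> n) z))\<^sup>2 * (norm (poly (\<phi> n) x))\<^sup>2"
      using AE AE_space
    proof eventually_elim
      case (elim x)
      have "(d * norm (poly q x))\<^sup>2 \<le> (norm (1 - x * cnj z) * norm (poly q x))\<^sup>2"
        using elim \<open>d > 0\<close> by (intro power_mono mult_right_mono) (auto simp: dz)
      also have "\<dots> \<le> (2 * norm (poly (\<phi> n) z) * norm (poly (\<phi> n) x))\<^sup>2"
        using elim by (intro pw) (simp add: space_mu)
      finally show ?case by (simp add: power_mult_distrib)
    qed
  qed (intro continuous_integrable continuous_intros)+
  then show ?thesis using 1 2 by simp
qed

lemma phi_nonzero_gap: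
  assumes "norm z = 1" "d > 0" "AE x in \<mu>. d \<le> dist x z"
  shows "poly (\<phi> n) z \<noteq> 0"
proof
  assume "poly (\<phi> n) z = 0"
  with kernel_diag_gap_bound[OF assms, of n] have "d\<^sup>2 * (\<Sum>k\<le>n. (norm (poly (\<phi> k) z))\<^sup>2) \<le> 0" by simp
  moreover have "d\<^sup>2 * (\<Sum>k\<le>n. (norm (poly (\<phi> k) z))\<^sup>2) > 0"
    using kernel_diag_pos[of z n] \<open>d > 0\<close> by simp
  ultimately show False by linarith
qed

lemma kernel_gap_bound:
  assumes z: "norm z = 1" and w: "norm w = 1" and d: "d > 0"
    and AE: "AE x in \<mu>. d \<le> dist x z" "AE x in \<mu>. d \<le> dist x w"
  shows "norm (kernel n z w) \<le> 4 / d\<^sup>2 * norm (poly (\<phi> n) z) * norm (poly (\<phi> n) w)"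
proof -
  have gap: "L2_set (\<lambda>k. norm (poly (\<phi> k) x)) {..n} \<le> 2 / d * norm (poly (\<phi> n) x)"
    if "norm x = 1" "AE y in \<mu>. d \<le> dist y x" for x
  proof -
    have "(\<Sum>k\<le>n. (norm (poly (\<phi> k) x))\<^sup>2) \<le> (2 / d * norm (poly (\<phi> n) x))\<^sup>2"
      using kernel_diag_gap_bound[OF that(1) d that(2), of n] d by (simp add: field_simps power_mult_distrib)
    then show ?thesis unfolding L2_set_def
      using d by (intro real_le_lsqrt) (auto intro: sum_nonneg)
  qed
  have "norm (kernel n z w) \<le> (\<Sum>k\<le>n. norm (poly (\<phi> k) z) * norm (poly (\<phi> k) w))"
    unfolding kernel_def by (rule order.trans[OF norm_sum]) (simp add: norm_mult)
  also have "\<dots> \<le> L2_set (\<lambda>k. norm (poly (\<phi> k) z)) {..n} * L2_set (\<lambda>k. norm (poly (\<phi> k) w)) {..n}"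
    using L2_set_mult_ineq[of "\<lambda>k. norm (poly (\<phi> k) z)" "\<lambda>k. norm (poly (\<phi> k) w)" "{..n}"] by simp
  also have "\<dots> \<le> (2 / d * norm (poly (\<phi> n) z)) * (2 / d * norm (poly (\<phi> n) w))"
    using gap[OF z AE(1)] gap[OF w AE(2)] d by (intro mult_mono) auto
  finally show ?thesis by (simp add: power2_eq_square)
qed

section \<open>Zeros of para-orthogonal polynomials in a gap\<close>

text \<open>This is the finite Blaschke product whose zeros are the origin and
  the zeros of \<open>\<phi>\<^sub>n\<close>.\<close>
definition blaschke :: "nat \<Rightarrow> complex \<Rightarrow> complex" where
  "blaschke n z = z * poly (\<phi> n) z / poly (star_poly (\<phi> n)) z"

lemma norm_star: "norm z = 1 \<Longrightarrow> norm (poly (star_poly (\<phi> n)) z) = norm (poly (\<phi> n) z)"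
  by (simp add: poly_star_poly_unit norm_mult norm_power)

text \<open>For unimodular values, \<open>|b\<^sub>n(z) - b\<^sub>n(w)| = |1 - b\<^sub>n(z) cnj (b\<^sub>n(w))|\<close>, and the
  Christoffel-Darboux formula evaluates the right-hand side in terms of the kernel.\<close>
lemma blaschke_lipschitz:
  assumes z: "norm z = 1" and w: "norm w = 1" and d: "d > 0"
    and AE: "AE x in \<mu>. d \<le> dist x z" "AE x in \<mu>. d \<le> dist x w"
  shows "dist (blaschke n z) (blaschke n w) \<le> 4 / d\<^sup>2 * dist z w"
proof -
  define P where "P = poly (\<phi> n)"
  define S where "S = poly (star_poly (\<phi> n))"
  have nS: "norm (S z) = norm (P z)" "norm (S w) = norm (P w)"
    using z w by (simp_all add: norm_star S_def P_def)
  have nz: "P z \<noteq> 0" "P w \<noteq> 0"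
    unfolding P_def using assms phi_nonzero_gap by blast+
  then have nzS: "S z \<noteq> 0" "S w \<noteq> 0" using nS by auto
  have nb: "norm (blaschke n w) = 1"
    using w nS nz by (simp add: blaschke_def norm_mult norm_divide P_def S_def)
  have "cnj (blaschke n w) * (blaschke n w - blaschke n z)
      = 1 - blaschke n z * cnj (blaschke n w)"
    using unit_mult_cnj[OF nb] by (simp add: algebra_simps)
  also have "\<dots> = (1 - z * cnj w) * kernel n z w / (S z * cnj (S w))"
    unfolding christoffel_darboux using nzS
    by (simp add: blaschke_def P_def S_def field_simps)
  finally have "norm (cnj (blaschke n w) * (blaschke n w - blaschke n z))
      = norm (1 - z * cnj w) * norm (kernel n z w) / (norm (P z) * norm (P w))"
    using nS by (simp add: norm_mult norm_divide)
  then have "dist (blaschke n z) (blaschke n w)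
      = norm (1 - z * cnj w) * (norm (kernel n z w) / (norm (P z) * norm (P w)))"
    using nb by (simp add: norm_mult dist_norm norm_minus_commute)
  also have "norm (1 - z * cnj w) = dist z w"
  proof -
    have "1 - z * cnj w = (w - z) * cnj w" using unit_mult_cnj[OF w] by (simp add: algebra_simps)
    then show ?thesis using w by (simp add: norm_mult dist_norm norm_minus_commute)
  qed
  also have "dist z w * (norm (kernel n z w) / (norm (P z) * norm (P w))) \<le> dist z w * (4 / d\<^sup>2)"
    by (rule mult_left_mono) (use kernel_gap_bound[OF assms, of n] nz in \<open>simp_all add: P_def pos_divide_le_eq mult.assoc\<close>)
  finally show ?thesis by (simp add: mult.commute)
qed

lemma para_zero_blaschke:
  assumes "poly (para_orthogonal \<phi> v (Suc n)) z = 0" and "poly (star_poly (\<phi> n)) z \<noteq> 0"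
  shows "blaschke n z = - v"
  using assms by (simp add: para_orthogonal_def blaschke_def field_simps eq_neg_iff_add_eq_0)

text \<open>The estimate compares the values of \<open>b\<^bsub>n+1\<^esub>\<close> at the two zeros. At \<open>z\<close> the value comes from
  the recurrence, which makes \<open>\<phi>\<^bsub>n+1\<^esub>(z)\<close> a multiple of \<open>b - v\<close>; since \<open>\<phi>\<^bsub>n+1\<^esub>\<close> has no zero in
  the gap, \<open>b \<noteq> v\<close>, which is why the denominator \<open>1 - b cnj v\<close> is nonzero.\<close>
lemma para_zero_dist:
  fixes v v' :: complex and n :: nat
  defines "b \<equiv> schur_param \<phi> (Suc n)"
  assumes zero: "poly (para_orthogonal \<phi> v (Suc n)) z = 0"
    "poly (para_orthogonal \<phi> v' (Suc (Suc n))) w = 0"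
    and v: "norm v = 1" "norm v' = 1" and d: "d > 0"
    and AE: "AE x in \<mu>. d \<le> dist x z" "AE x in \<mu>. d \<le> dist x w"
  shows "dist (v' / v * ((1 - cnj b * v) / (1 - b * cnj v))) z \<le> 4 / d\<^sup>2 * dist z w"
proof -
  have z: "norm z = 1" and w: "norm w = 1"
    using para_zero_unit zero v by blast+
  have vv: "v * cnj v = 1" using v(1) by (rule unit_mult_cnj)
  define c where "c = complex_of_real (\<kappa> (Suc n) / \<kappa> n)"
  define S where "S = poly (star_poly (\<phi> n)) z"
  have P: "z * poly (\<phi> n) z = - (v * S)"
    using zero(1) by (simp add: para_orthogonal_def S_def eq_neg_iff_add_eq_0)
  have rec: "poly (\<phi> (Suc n)) z = c * (z * poly (\<phi> n) z + b * S)"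
    "poly (star_poly (\<phi> (Suc n))) z = c * (S + cnj b * (z * poly (\<phi> n) z))"
    by (subst szego_recurrence szego_recurrence_star, simp add: c_def b_def S_def)+
  have p1: "poly (\<phi> (Suc n)) z = c * S * (b - v)"
    unfolding rec P by (simp add: algebra_simps)
  have s1: "poly (star_poly (\<phi> (Suc n))) z = c * S * (1 - cnj b * v)"
    unfolding rec P by (simp add: algebra_simps)
  have nz: "poly (\<phi> (Suc n)) z \<noteq> 0" by (rule phi_nonzero_gap[OF z d AE(1)])
  have nw: "poly (\<phi> (Suc n)) w \<noteq> 0" by (rule phi_nonzero_gap[OF w d AE(2)])
  have nb: "b \<noteq> v" "c * S \<noteq> 0" using nz p1 by auto
  have e: "b - v = - (v * (1 - b * cnj v))" using vv by (simp add: algebra_simps)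
  define D where "D = 1 - b * cnj v"
  have D: "D \<noteq> 0" using e nb by (auto simp: D_def)
  have *: "(v' - z * v * D / X) * (X / (v * D)) = v' / v * (X / D) - z"
    if "X \<noteq> 0" "D \<noteq> 0" "v \<noteq> 0" for X
    using that by (simp add: field_simps)
  have cD: "1 - cnj b * v = cnj D" by (simp add: D_def)
  have "blaschke (Suc n) z = - (z * v * D / cnj D)"
    unfolding blaschke_def p1 s1 e using nb(2) by (simp add: cD flip: D_def)
  moreover have "blaschke (Suc n) w = - v'"
    using para_zero_blaschke[OF zero(2)] nw norm_star[OF w, of "Suc n"] by fastforce
  ultimately have "dist (blaschke (Suc n) z) (blaschke (Suc n) w) = norm (v' - z * v * D / cnj D)"
    by (simp add: dist_norm)
  \<comment> \<open>Multiply by a number of modulus one that turns the second term into \<open>z\<close>.\<close>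
  also have "\<dots> = norm ((v' - z * v * D / cnj D) * (cnj D / (v * D)))"
    using D v by (simp add: norm_mult norm_divide)
  also have "(v' - z * v * D / cnj D) * (cnj D / (v * D)) = v' / v * (cnj D / D) - z"
    using *[of "cnj D"] D v by fastforce
  finally show ?thesis
    using blaschke_lipschitz[OF z w d AE, of "Suc n"] unfolding cD D_def[symmetric]
    by (simp add: dist_norm)
qed

end

section \<open>Double limit points off the support\<close>

theorem theorem4p18:
  fixes \<mu> :: "complex measure"
    and \<phi> :: "nat \<Rightarrow> complex poly"
    and a u :: "nat \<Rightarrow> complex"
  assumes "prob_space \<mu>"
    and "sets \<mu> = sets (restrict_space borel (sphere 0 1))"
    and "infinite (measure_supp \<mu>)"
    and "orthonormal_polys \<mu> \<phi>"
    and "\<And>n. n \<ge> 1 \<Longrightarrow> a n = schur_param \<phi> n"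
    and "\<And>n. n \<ge> 1 \<Longrightarrow> u n \<in> sphere 0 1"
  shows "double_limit_points (para_zeros \<phi> u) - measure_supp \<mu>
           \<subseteq> subseq_limits (\<lambda>n. u (n + 1) / u n * ((1 - cnj (a n) * u n) / (1 - a n * cnj (u n))))"
proof
  interpret circle_OP \<mu> \<phi>
    using assms(1,2,4) by (simp add: circle_OP_def circle_OP_axioms_def)
  define E where "E = para_zeros \<phi> u"
  define c where "c = (\<lambda>n. u (n + 1) / u n * ((1 - cnj (a n) * u n) / (1 - a n * cnj (u n))))"
  have u: "norm (u n) = 1" if "n \<ge> 1" for n using assms(6)[OF that] by simp
  fix l assume l: "l \<in> double_limit_points (para_zeros \<phi> u) - measure_supp \<mu>"
  then obtain I where I: "infinite I" "I \<subseteq> {n. n \<ge> 1 \<and> E n \<noteq> {} \<and> E (n + 1) \<noteq> {}}"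
    and lim: "((\<lambda>n. infdist l (E n)) \<longlongrightarrow> 0) (inf sequentially (principal I))"
      "((\<lambda>n. infdist l (E (n + 1))) \<longlongrightarrow> 0) (inf sequentially (principal I))"
    unfolding double_limit_points_def E_def by blast
  define r where "r = enumerate I"
  have r: "strict_mono r" "\<And>n. r n \<in> I"
    using I(1) by (simp_all add: r_def strict_mono_enumerate enumerate_in_set)
  have r1: "r n \<ge> 1" "E (r n) \<noteq> {}" "E (r n + 1) \<noteq> {}" for n using r(2) I(2) by blast+
  have "filterlim r (inf sequentially (principal I)) sequentially"
    using r by (auto simp: filterlim_inf filterlim_principal intro: filterlim_subseq)
  then have lim': "(\<lambda>n. infdist l (E (r n))) \<longlonglongrightarrow> 0" "(\<lambda>n. infdist l (E (r n + 1))) \<longlonglongrightarrow> 0"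
    using lim filterlim_compose by blast+
  have near: "\<exists>z. z \<in> A \<and> dist z l < e" if "A \<noteq> {}" "infdist l A < e" for A :: "complex set" and e
    using that infdist_attains_inf cInf_lessD[of "(\<lambda>a. dist l a) ` A" e]
    by (auto simp: infdist_notempty dist_commute)
  \<comment> \<open>The term \<open>1 / (n + 1)\<close> makes the inequality strict, so that a near-minimiser exists.\<close>
  have "\<exists>z. z \<in> E (r n) \<and> dist z l < infdist l (E (r n)) + inverse (real (Suc n))" for n
    using r1 by (intro near) auto
  then obtain z where z: "\<And>n. z n \<in> E (r n)"
    "\<And>n. dist (z n) l < infdist l (E (r n)) + inverse (real (Suc n))" by metis
  have "\<exists>z. z \<in> E (r n + 1) \<and> dist z l < infdist l (E (r n + 1)) + inverse (real (Suc n))" for n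
    using r1 by (intro near) auto
  then obtain w where w: "\<And>n. w n \<in> E (r n + 1)"
    "\<And>n. dist (w n) l < infdist l (E (r n + 1)) + inverse (real (Suc n))" by metis
  have conv: "x \<longlonglongrightarrow> l" if "f \<longlonglongrightarrow> 0" "\<And>n. dist (x n) l < f n + inverse (real (Suc n))" for x f
  proof -
    have "(\<lambda>n. f n + inverse (real (Suc n))) \<longlonglongrightarrow> 0"
      using tendsto_add[OF that(1) LIMSEQ_inverse_real_of_nat] by simp
    then have "(\<lambda>n. dist (x n) l) \<longlonglongrightarrow> 0"
      by (rule tendsto_sandwich[OF _ _ tendsto_const, rotated 2])
         (intro always_eventually allI less_imp_le that(2) zero_le_dist)+
    then show ?thesis by (rule iffD2[OF tendsto_dist_iff])
  qed
  have zl: "z \<longlonglongrightarrow> l" and wl: "w \<longlonglongrightarrow> l"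
    using conv[OF lim'(1) z(2)] conv[OF lim'(2) w(2)] .
  have zero: "poly (para_orthogonal \<phi> (u (r n)) (Suc (r n - 1))) (z n) = 0"
    "poly (para_orthogonal \<phi> (u (r n + 1)) (Suc (Suc (r n - 1)))) (w n) = 0" for n
    using z(1)[of n] w(1)[of n] r1(1)[of n] by (simp_all add: E_def para_zeros_def)
  have "z n \<in> sphere 0 1" for n
    using para_zero_unit[OF zero(1) u[OF r1(1)]] by simp
  then have "l \<in> sphere 0 1"
    using closed_sphere[of 0 1] zl closed_sequentially by blast
  with l obtain U where U: "open U" "l \<in> U" "emeasure \<mu> (U \<inter> space \<mu>) = 0"
    unfolding measure_supp_def space_mu by (auto simp: not_gr_zero)
  obtain e where e: "e > 0" "ball l e \<subseteq> U" using U open_contains_ball by blast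
  \<comment> \<open>Half the radius, so that points within \<open>d\<close> of \<open>l\<close> have distance at least \<open>d\<close> from almost every point.\<close>
  define d where "d = e / 2"
  have d: "d > 0" using e by (simp add: d_def)
  have "U \<inter> space \<mu> \<in> sets \<mu>"
    unfolding sets_mu space_mu sets_restrict_space
    using borel_open[OF U(1)] by (metis Int_commute imageI)
  with U(3) have "U \<inter> space \<mu> \<in> null_sets \<mu>" by (intro null_setsI)
  from AE_not_in[OF this] AE_space have "AE x in \<mu>. x \<notin> U"
    by eventually_elim simp
  then have AE: "AE x in \<mu>. d \<le> dist x y" if "dist y l < d" for y
  proof eventually_elim
    case (elim x)
    then have "e \<le> dist l x" using e(2) by (auto simp: subset_eq not_less)
    with that show ?case using dist_triangle[of l x y] by (simp add: d_def dist_commute)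
  qed
  have "\<forall>\<^sub>F n in sequentially. dist (z n) l < d" "\<forall>\<^sub>F n in sequentially. dist (w n) l < d"
    using zl wl d by (auto dest: tendstoD)
  then have "\<forall>\<^sub>F n in sequentially. dist (c (r n)) (z n) \<le> 4 / d\<^sup>2 * dist (z n) (w n)"
  proof eventually_elim
    case (elim n)
    show ?case
      using para_zero_dist[OF zero[of n] u[OF r1(1)] u d AE[OF elim(1)] AE[OF elim(2)]]
        r1(1)[of n] assms(5)[OF r1(1), of n] by (simp add: c_def)
  qed
  moreover have "(\<lambda>n. 4 / d\<^sup>2 * dist (z n) (w n)) \<longlonglongrightarrow> 0"
    using tendsto_mult[OF tendsto_const[of "4 / d\<^sup>2"] tendsto_dist[OF zl wl]] by simp
  ultimately have "(\<lambda>n. dist (c (r n)) (z n)) \<longlonglongrightarrow> 0"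
    by (rule tendsto_sandwich[OF always_eventually _ tendsto_const, rotated 1])
       (intro allI zero_le_dist)
  then have "(\<lambda>n. c (r n) - z n) \<longlonglongrightarrow> 0"
    by (simp add: dist_norm tendsto_norm_zero_iff)
  from tendsto_add[OF this zl] have "(c \<circ> r) \<longlonglongrightarrow> l" by (simp add: o_def)
  with r(1) show "l \<in> subseq_limits (\<lambda>n. u (n + 1) / u n * ((1 - cnj (a n) * u n) / (1 - a n * cnj (u n))))"
    unfolding subseq_limits_def c_def by blast
qed

end
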